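(* Let $v>k>i\ge 0$ be integers with $v\ge 2k$ and $(v,k,i)\neq(2k,k,0)$, let $X=J(v,k,i)$ and $\Delta=v-2k+2i$. Let $A,B$ be vertices of $X$ and $x=|A\cap B|$. Then $$\mathrm{dist}(A,B)= \begin{cases} 3 & \text{if } x<\min\{i,k-\Delta\}; \\ \lceil\frac{k-x}{k-i}\rceil & \text{if } k-\Delta\leq x< i; \\ \min\{2\lceil \frac{k-x}{\Delta} \rceil,2\lceil \frac{x-i}{\Delta} \rceil +1\} & \text{if } x \geq i. \end{cases}$$
   Context: For integers $v>k>i\ge 0$, the generalized Johnson graph $J(v,k,i)$ is the simple undirected graph whose vertices are the $k$-element subsets of a fixed $v$-element set, two vertices $A,B$ being adjacent iff $|A\cap B|=i$. $\mathrm{dist}$ denotes the graph distance. *)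

theory Defs
  imports Complex_Main "Graph_Theory.Graph_Theory"
begin

text \<open>
  In Graph_Theory a simple undirected graph is a finite, loop-free, symmetric digraph without
  parallel arcs (locale \<^locale>\<open>pair_graph\<close>): an edge between \<open>A\<close> and \<open>B\<close> is the pair of arcs
  \<open>(A, B)\<close> and \<open>(B, A)\<close>. The ground set \<open>V\<close> is arbitrary; it plays the role of the fixed
  \<open>v\<close>-element set of \<open>J(v,k,i)\<close> when \<open>card V = v\<close>.
\<close>

definition gen_johnson_graph :: "'a set \<Rightarrow> nat \<Rightarrow> nat \<Rightarrow> 'a set pair_pre_digraph" where
  "gen_johnson_graph V k i =
     \<lparr> pverts = {A. A \<subseteq> V \<and> card A = k},
       parcs = {(A, B). A \<subseteq> V \<and> card A = k \<and> B \<subseteq> V \<and> card B = k \<and> card (A \<inter> B) = i} \<rparr>"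

lemma pair_graph_gen_johnson_graph:
  assumes "finite V" "i < k"
  shows "pair_graph (gen_johnson_graph V k i)"
proof -
  let ?P = "{A. A \<subseteq> V \<and> card A = k}"
  have fin: "finite ?P"
    by (rule finite_subset[of _ "Pow V"]) (use assms(1) in auto)
  have sub: "parcs (gen_johnson_graph V k i) \<subseteq> ?P \<times> ?P"
    by (auto simp: gen_johnson_graph_def)
  have fin_arcs: "finite (parcs (gen_johnson_graph V k i))"
    by (rule finite_subset[OF sub]) (rule finite_cartesian_product[OF fin fin])
  have sym: "sym (parcs (gen_johnson_graph V k i))"
    by (rule symI) (simp add: gen_johnson_graph_def Int_commute)
  have no_loops: "fst e \<noteq> snd e" if "e \<in> parcs (gen_johnson_graph V k i)" for e
  proof
    assume "fst e = snd e"
    with that have "card (fst e) = k" "card (fst e) = i"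
      unfolding gen_johnson_graph_def by (simp_all add: case_prod_beta)
    with assms(2) show False by (metis less_irrefl)
  qed
  show ?thesis
  proof (unfold_locales, goal_cases)
    case (1 e) then show ?case using sub by (auto simp: gen_johnson_graph_def)
  next
    case (2 e) then show ?case using sub by (auto simp: gen_johnson_graph_def)
  next
    case 3 then show ?case using fin by (simp add: gen_johnson_graph_def)
  next
    case 4 then show ?case by (rule fin_arcs)
  next
    case (5 e) then show ?case by (rule no_loops)
  next
    case 6 then show ?case unfolding symmetric_def with_proj_simps by (rule sym)
  qed
qed

text \<open>
  The graph distance is the shortest-path distance for unit arc costs, i.e. the least number of
  arcs of a walk from \<open>A\<close> to \<open>B\<close>. It is an extended real, and \<open>\<infinity>\<close> if there is no such walk.
\<close>

definition graph_dist :: "'a pair_pre_digraph \<Rightarrow> 'a \<Rightarrow> 'a \<Rightarrow> ereal" where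
  "graph_dist G A B = wf_digraph.\<mu> (with_proj G) (\<lambda>_. 1) A B"

end

theory Submission
  imports Defs
begin

text \<open>
  Let \<open>C\<close> be adjacent to \<open>A\<close> and put \<open>x = |A \<inter> B|\<close>, \<open>y = |C \<inter> B|\<close>. Nonnegativity of the Venn
  regions of \<open>A, B, C\<close> shows that \<open>y\<close> can occur iff \<open>k + i - \<Delta> \<le> x + y \<le> k + i\<close> and
  \<open>|x - y| \<le> k - i\<close>. Iterating, a walk of length \<open>n\<close> from \<open>A\<close> to \<open>B\<close> exists iff
  \<open>x \<ge> k - n (k - i)\<close> and moreover \<open>x \<ge> k - m \<Delta>\<close> if \<open>n = 2 m\<close>, and \<open>x \<le> i + m \<Delta>\<close> if
  \<open>n = 2 m + 1\<close>. The distance is the least such \<open>n\<close>.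
\<close>

section \<open>Arithmetic of a single step of a walk\<close>

definition walk_bounds :: "int \<Rightarrow> int \<Rightarrow> int \<Rightarrow> nat \<Rightarrow> int \<Rightarrow> bool" where
  "walk_bounds k i \<Delta> n x \<longleftrightarrow> k - int n * (k - i) \<le> x \<and>
     (if even n then k - int (n div 2) * \<Delta> \<le> x else x \<le> i + int (n div 2) * \<Delta>)"

definition step_bounds :: "int \<Rightarrow> int \<Rightarrow> int \<Rightarrow> int \<Rightarrow> int \<Rightarrow> bool" where
  "step_bounds k i \<Delta> x y \<longleftrightarrow> k + i - \<Delta> \<le> x + y \<and> x + y \<le> k + i \<and> \<bar>x - y\<bar> \<le> k - i"

text \<open>Here and in the odd case the only nonlinear terms are \<open>int m * (k - i)\<close> and
  \<open>int m * \<Delta>\<close>, which linear arithmetic can treat as atoms.\<close>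

lemma walk_bounds_even:
  "walk_bounds k i \<Delta> (2 * m) x \<longleftrightarrow> k - 2 * (int m * (k - i)) \<le> x \<and> k - int m * \<Delta> \<le> x"
  by (simp add: walk_bounds_def mult.assoc)

lemma walk_bounds_odd:
  "walk_bounds k i \<Delta> (Suc (2 * m)) x \<longleftrightarrow>
     i - 2 * (int m * (k - i)) \<le> x \<and> x \<le> i + int m * \<Delta>"
  by (simp add: walk_bounds_def algebra_simps)

text \<open>The upper bound on \<open>x + y\<close> turns the even lower bound on \<open>y\<close>
  into the odd upper bound on \<open>x\<close>. The lower bound on \<open>x + y\<close> turns the
  odd upper bound into the next even lower bound, at the cost of one more \<open>\<Delta>\<close>.
  The bound on \<open>\<bar>x - y\<bar>\<close> adds one \<open>k - i\<close>.\<close>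

lemma walk_bounds_step:
  assumes "step_bounds k i \<Delta> x y" and "walk_bounds k i \<Delta> n y"
  shows "walk_bounds k i \<Delta> (Suc n) x"
proof (cases "even n")
  case True
  then obtain m where n: "n = 2 * m" by (auto elim: evenE)
  show ?thesis
    using assms unfolding n walk_bounds_even walk_bounds_odd step_bounds_def by linarith
next
  case False
  then obtain m where n: "n = Suc (2 * m)" by (auto elim: oddE)
  have Suc_n: "Suc n = 2 * Suc m" using n by simp
  show ?thesis
    using assms unfolding Suc_n unfolding n walk_bounds_even walk_bounds_odd step_bounds_def
    by (auto simp: algebra_simps)
qed

text \<open>Eliminates an unknown \<open>y\<close> as in Fourier-Motzkin: comparing bounds in pairs
  suffices, since the largest lower bound is a witness.\<close>

lemma interval_int_exists:
  fixes L U :: "int set"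
  assumes "finite L" "L \<noteq> {}" "\<And>l u. l \<in> L \<Longrightarrow> u \<in> U \<Longrightarrow> l \<le> u"
  shows "\<exists>y. (\<forall>l\<in>L. l \<le> y) \<and> (\<forall>u\<in>U. y \<le> u)"
  using assms by (intro exI[of _ "Max L"]) auto

text \<open>Every condition on \<open>y\<close> is a lower or an upper bound, so \<open>y\<close> is
  eliminated by comparing each lower bound with each upper one.\<close>

lemma walk_bounds_step_exists:
  assumes i: "0 \<le> i" "i < k" and \<Delta>: "2 * i \<le> \<Delta>" and x: "0 \<le> x" "x \<le> k"
    and walk: "walk_bounds k i \<Delta> (Suc n) x"
  shows "\<exists>y. 0 \<le> y \<and> y \<le> k \<and> step_bounds k i \<Delta> x y \<and> walk_bounds k i \<Delta> n y"
proof (cases "even n")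
  case True
  then obtain m where n: "n = 2 * m" by (auto elim: evenE)
  have R: "i - 2 * (int m * (k - i)) \<le> x" "x \<le> i + int m * \<Delta>"
    using walk unfolding n walk_bounds_odd by auto
  \<comment> \<open>The case \<open>m = 0\<close> is separate: there \<open>R\<close> forces
    \<open>x = i\<close>, and \<open>y\<close> must be \<open>k\<close>. For \<open>m > 0\<close>
    the products are at least \<open>k - i\<close> and \<open>\<Delta>\<close>, which leaves enough
    slack.\<close>
  have m: "int m * (k - i) = 0 \<and> int m * \<Delta> = 0 \<or> k - i \<le> int m * (k - i) \<and> \<Delta> \<le> int m * \<Delta>"
    using i \<Delta> by (auto simp: mult_le_cancel_right1)
  have "\<exists>y. (\<forall>l\<in>{k + i - \<Delta> - x, x - k + i, 0, k - 2 * (int m * (k - i)), k - int m * \<Delta>}. l \<le> y) \<and>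
            (\<forall>u\<in>{k + i - x, x + k - i, k}. y \<le> u)"
  proof (rule interval_int_exists)
    fix l u
    assume "l \<in> {k + i - \<Delta> - x, x - k + i, 0, k - 2 * (int m * (k - i)), k - int m * \<Delta>}"
      and "u \<in> {k + i - x, x + k - i, k}"
    then show "l \<le> u"
      using m R assms(1-5) by (elim insertE emptyE disjE conjE; linarith)
  qed auto
  then obtain y where "k + i - \<Delta> - x \<le> y" "x - k + i \<le> y" "0 \<le> y"
      "k - 2 * (int m * (k - i)) \<le> y" "k - int m * \<Delta> \<le> y"
      "y \<le> k + i - x" "y \<le> x + k - i" "y \<le> k"
    by auto
  then show ?thesis
    unfolding n walk_bounds_even step_bounds_def by (intro exI[of _ y] conjI; linarith)
next
  case False
  then obtain m where n: "n = Suc (2 * m)" by (auto elim: oddE)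
  have Suc_n: "Suc n = 2 * Suc m" using n by simp
  have R: "i - 2 * (int m * (k - i)) - (k - i) \<le> x" "k - \<Delta> - int m * \<Delta> \<le> x"
    using walk unfolding Suc_n walk_bounds_even by (auto simp: algebra_simps)
  have m: "0 \<le> int m * (k - i)" "0 \<le> int m * \<Delta>"
    using i \<Delta> by auto
  have "\<exists>y. (\<forall>l\<in>{k + i - \<Delta> - x, x - k + i, 0, i - 2 * (int m * (k - i))}. l \<le> y) \<and>
            (\<forall>u\<in>{k + i - x, x + k - i, k, i + int m * \<Delta>}. y \<le> u)"
  proof (rule interval_int_exists)
    fix l u
    assume "l \<in> {k + i - \<Delta> - x, x - k + i, 0, i - 2 * (int m * (k - i))}"
      and "u \<in> {k + i - x, x + k - i, k, i + int m * \<Delta>}"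
    then show "l \<le> u"
      using m R assms(1-5) by (elim insertE emptyE disjE conjE; linarith)
  qed auto
  then obtain y where "k + i - \<Delta> - x \<le> y" "x - k + i \<le> y" "0 \<le> y"
      "i - 2 * (int m * (k - i)) \<le> y"
      "y \<le> k + i - x" "y \<le> x + k - i" "y \<le> k" "y \<le> i + int m * \<Delta>"
    by auto
  then show ?thesis
    unfolding n walk_bounds_odd step_bounds_def by (intro exI[of _ y] conjI; linarith)
qed

section \<open>Intersection sizes realized by neighbours\<close>

text \<open>The sum \<open>x + y\<close> counts \<open>(A \<union> C) \<inter> B\<close> once and
  \<open>A \<inter> C \<inter> B\<close> once more, hence is at most \<open>k + i\<close>. It is
  bounded below because \<open>A \<union> C \<union> B\<close> fits into \<open>V\<close>. Passing
  from \<open>A\<close> to \<open>C\<close> exchanges \<open>k - i\<close> elements, which bounds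
  the difference.\<close>

lemma step_bounds_necessary:
  assumes "finite V" "A \<subseteq> V" "B \<subseteq> V" "C \<subseteq> V"
    and "card A = k" "card B = k" "card C = k" "card (A \<inter> C) = i"
  shows "step_bounds (int k) (int i) (int (card V) - 2 * int k + 2 * int i)
           (int (card (A \<inter> B))) (int (card (C \<inter> B)))"
proof -
  have fin: "finite A" "finite B" "finite C"
    using assms finite_subset by blast+
  have AC: "card (A \<union> C) + i = 2 * k"
    using card_Un_Int[OF fin(1,3)] assms by simp
  have inter: "card (A \<inter> B) + card (C \<inter> B) = card ((A \<union> C) \<inter> B) + card (A \<inter> C \<inter> B)"
    using card_Un_Int[of "A \<inter> B" "C \<inter> B"] fin by (simp add: Int_Un_distrib Int_Un_distrib2 Int_ac)
  have union: "card (A \<union> C) + k = card (A \<union> C \<union> B) + card ((A \<union> C) \<inter> B)"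
    using card_Un_Int[of "A \<union> C" B] fin assms by simp
  have V: "card (A \<union> C \<union> B) \<le> card V"
    using assms by (intro card_mono) auto
  have B: "card ((A \<union> C) \<inter> B) \<le> k" and I: "card (A \<inter> C \<inter> B) \<le> i"
    using assms fin card_mono[of B "(A \<union> C) \<inter> B"] card_mono[of "A \<inter> C" "A \<inter> C \<inter> B"] by auto
  have x: "card (A \<inter> B) \<le> card ((A \<union> C) \<inter> B)" and y: "card (C \<inter> B) \<le> card ((A \<union> C) \<inter> B)"
    using fin by (auto intro!: card_mono)
  have xC: "card (A \<inter> B) \<le> card (C \<inter> B) + (k - i)" and yA: "card (C \<inter> B) \<le> card (A \<inter> B) + (k - i)"
  proof -
    have "card (A \<inter> B) \<le> card ((C \<inter> B) \<union> (A - C))" "card (C \<inter> B) \<le> card ((A \<inter> B) \<union> (C - A))"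
      using fin by (auto intro!: card_mono)
    moreover have "card (A - C) = k - i" "card (C - A) = k - i"
      using assms fin by (simp_all add: card_Diff_subset_Int Int_commute)
    ultimately show "card (A \<inter> B) \<le> card (C \<inter> B) + (k - i)" "card (C \<inter> B) \<le> card (A \<inter> B) + (k - i)"
      by (metis card_Un_le le_trans)+
  qed
  have "i \<le> k"
    using assms fin card_mono[of A "A \<inter> C"] by auto
  then show ?thesis
    using AC inter union V B I xC yA unfolding step_bounds_def by linarith
qed

text \<open>Fixing the size \<open>t\<close> of \<open>A \<inter> B \<inter> C\<close> determines
  the sizes of the other three pieces of \<open>C\<close>: inside \<open>A - B\<close>, inside
  \<open>B - A\<close> and outside both. It remains to choose \<open>t\<close> so that every piece
  fits into its region.\<close>

lemma step_bounds_sufficient: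
  assumes fin: "finite V" and sub: "A \<subseteq> V" "B \<subseteq> V" and card: "card A = k" "card B = k"
    and "i < k" "y \<le> k" "2 * k \<le> card V"
    and step: "step_bounds (int k) (int i) (int (card V) - 2 * int k + 2 * int i)
           (int (card (A \<inter> B))) (int y)"
  obtains C where "C \<subseteq> V" "card C = k" "card (A \<inter> C) = i" "card (C \<inter> B) = y"
proof -
  define x where "x = card (A \<inter> B)"
  \<comment> \<open>the least admissible size of \<open>A \<inter> B \<inter> C\<close>\<close>
  define t where "t = max (max 0 (x + y - k)) (max (x + i - k) (y + i - k))"
  have finAB: "finite A" "finite B"
    using fin sub finite_subset by blast+
  have "x \<le> k"
    using card_mono[of A "A \<inter> B"] finAB card by (simp add: x_def)
  have AB: "card (A - B) = k - x" and BA: "card (B - A) = k - x"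
    using card finAB by (simp_all add: card_Diff_subset_Int Int_commute x_def)
  have U: "card (V - (A \<union> B)) = card V + x - 2 * k"
  proof -
    have "card (A \<union> B) + x = 2 * k"
      using card_Un_Int[OF finAB] card by (simp add: x_def)
    moreover have "card (V - (A \<union> B)) = card V - card (A \<union> B)"
      using finAB sub by (intro card_Diff_subset) auto
    ultimately show ?thesis using assms(8) by linarith
  qed
  \<comment> \<open>The upper bound on \<open>x + y\<close> is what gives \<open>t \<le> i\<close>,
    the bound on the difference gives \<open>t \<le> x\<close> and \<open>t \<le> y\<close>, and the
    lower bound on \<open>x + y\<close> leaves room outside \<open>A \<union> B\<close>. These
    inequalities also make the natural-number subtractions below exact.\<close>
  have t: "t \<le> x" "t \<le> y" "t \<le> i" "y - t \<le> k - x" "i - t \<le> k - x" "y + i \<le> k + t"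
      "k + t - (y + i) \<le> card V + x - 2 * k"
    using step assms(6-8) \<open>x \<le> k\<close> unfolding step_bounds_def x_def[symmetric] t_def by linarith+
  obtain T where T: "T \<subseteq> A \<inter> B" "card T = t"
    using obtain_subset_with_card_n[of t "A \<inter> B"] t(1) unfolding x_def by metis
  obtain P where P: "P \<subseteq> A - B" "card P = i - t"
    using obtain_subset_with_card_n[of "i - t" "A - B"] t(5) AB by metis
  obtain Q where Q: "Q \<subseteq> B - A" "card Q = y - t"
    using obtain_subset_with_card_n[of "y - t" "B - A"] t(4) BA by metis
  obtain R where R: "R \<subseteq> V - (A \<union> B)" "card R = k + t - (y + i)"
    using obtain_subset_with_card_n[of "k + t - (y + i)" "V - (A \<union> B)"] t(7) U by metis
  have fins: "finite T" "finite P" "finite Q" "finite R"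
    using T P Q R fin finAB by (meson finite_Diff finite_Int finite_subset)+
  show thesis
  proof (rule that[of "T \<union> P \<union> (Q \<union> R)"])
    show "T \<union> P \<union> (Q \<union> R) \<subseteq> V"
      using T P Q R sub by blast
    have TP: "card (T \<union> P) = i"
      using T P t fins by (subst card_Un_disjoint) auto
    have TQ: "card (T \<union> Q) = y"
      using T Q t fins by (subst card_Un_disjoint) auto
    have QR: "card (Q \<union> R) = (y - t) + (k + t - (y + i))"
      using Q R fins by (subst card_Un_disjoint) auto
    have "card (T \<union> P \<union> (Q \<union> R)) = card (T \<union> P) + card (Q \<union> R)"
      using T P Q R fins by (intro card_Un_disjoint) auto
    then show "card (T \<union> P \<union> (Q \<union> R)) = k"
      using TP QR t assms(6) by linarith
    have "A \<inter> (T \<union> P \<union> (Q \<union> R)) = T \<union> P" "(T \<union> P \<union> (Q \<union> R)) \<inter> B = T \<union> Q"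
      using T P Q R by blast+
    then show "card (A \<inter> (T \<union> P \<union> (Q \<union> R))) = i" "card ((T \<union> P \<union> (Q \<union> R)) \<inter> B) = y"
      using TP TQ by simp_all
  qed
qed

section \<open>Walks of a given length\<close>

text \<open>Induction on the length with \<open>B\<close> fixed and the start vertex varying: the
  first arc is split off, and the neighbour reached matters only through its intersection size with
  \<open>B\<close>.\<close>

lemma johnson_walk_iff:
  fixes V :: "'a set" and k i :: nat
  defines "G \<equiv> gen_johnson_graph V k i"
    and "\<Delta> \<equiv> int (card V) - 2 * int k + 2 * int i"
  assumes fin: "finite V" and "i < k" "2 * k \<le> card V"
    and "A \<in> pverts G" and B: "B \<in> pverts G"
  shows "(\<exists>p. pre_digraph.awalk (with_proj G) A p B \<and> length p = n) \<longleftrightarrow>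
         walk_bounds (int k) (int i) \<Delta> n (int (card (A \<inter> B)))"
  using \<open>A \<in> pverts G\<close>
proof (induction n arbitrary: A)
  interpret pair_graph G
    unfolding G_def using fin \<open>i < k\<close> by (rule pair_graph_gen_johnson_graph)
  have vert: "C \<in> pverts G \<longleftrightarrow> C \<subseteq> V \<and> card C = k" for C
    by (simp add: G_def gen_johnson_graph_def)
  have arc: "(C, D) \<in> parcs G \<longleftrightarrow> C \<in> pverts G \<and> D \<in> pverts G \<and> card (C \<inter> D) = i" for C D
    by (auto simp: G_def gen_johnson_graph_def)
  have finv: "finite C" if "C \<in> pverts G" for C
    using that fin vert finite_subset by blast
  have inter_le: "card (C \<inter> B) \<le> k" for C
    using finv[OF B] B vert card_mono[of B "C \<inter> B"] by auto
  {
    case (0 A)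
    \<comment> \<open>At length 0 the bounds say \<open>k \<le> card (A \<inter> B)\<close>, which
      forces equality of two \<open>k\<close>-sets.\<close>
    have "A = B" if "k \<le> card (A \<inter> B)"
    proof -
      have "A \<inter> B = A"
        using that 0 finv vert card_seteq[of A "A \<inter> B"] by simp
      moreover have "A \<inter> B = B"
        using that B finv vert card_seteq[of B "A \<inter> B"] by simp
      ultimately show ?thesis by simp
    qed
    moreover have "card (A \<inter> B) = k" if "A = B"
      using that B vert by simp
    ultimately show ?case
      using 0 by (auto simp: awalk_Nil_iff walk_bounds_def)
  next
    case (Suc n A)
    have "(\<exists>p. awalk A p B \<and> length p = Suc n) \<longleftrightarrow>
          (\<exists>C. (A, C) \<in> parcs G \<and> (\<exists>p. awalk C p B \<and> length p = n))"
    proof safe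
      fix p assume "awalk A p B" "length p = Suc n"
      then show "\<exists>C. (A, C) \<in> parcs G \<and> (\<exists>p. awalk C p B \<and> length p = n)"
      proof (cases p)
        case (Cons e q)
        then have "(A, snd e) \<in> parcs G" "awalk (snd e) q B" "length q = n"
          using \<open>awalk A p B\<close> \<open>length p = Suc n\<close> by (auto simp: awalk_Cons_iff)
        then show ?thesis by blast
      qed simp
    next
      fix C p assume "(A, C) \<in> parcs G" "awalk C p B" "n = length p"
      then show "\<exists>q. awalk A q B \<and> length q = Suc (length p)"
        by (intro exI[of _ "(A, C) # p"]) (auto simp: awalk_Cons_iff)
    qed
    also have "\<dots> \<longleftrightarrow> (\<exists>C. (A, C) \<in> parcs G \<and> walk_bounds k i \<Delta> n (card (C \<inter> B)))"
      using Suc.IH arc by (intro ex_cong1) auto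
    also have "\<dots> \<longleftrightarrow> walk_bounds k i \<Delta> (Suc n) (card (A \<inter> B))"
    proof safe
      fix C assume "(A, C) \<in> parcs G" and walk: "walk_bounds k i \<Delta> n (card (C \<inter> B))"
      then have "step_bounds k i \<Delta> (card (A \<inter> B)) (card (C \<inter> B))"
        unfolding \<Delta>_def using B fin arc vert by (intro step_bounds_necessary) auto
      then show "walk_bounds k i \<Delta> (Suc n) (card (A \<inter> B))"
        using walk by (rule walk_bounds_step)
    next
      assume "walk_bounds k i \<Delta> (Suc n) (card (A \<inter> B))"
      moreover have "2 * int i \<le> \<Delta>" using assms by simp
      ultimately obtain y :: int where y: "0 \<le> y" "y \<le> k"
          "step_bounds k i \<Delta> (card (A \<inter> B)) y" "walk_bounds k i \<Delta> n y"
        using walk_bounds_step_exists[of i k \<Delta> "card (A \<inter> B)" n] \<open>i < k\<close> inter_le by auto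
      obtain C where "C \<subseteq> V" "card C = k" "card (A \<inter> C) = i" "card (C \<inter> B) = nat y"
        by (rule step_bounds_sufficient[of V A B k i "nat y"])
          (use fin Suc.prems B vert assms(4,5) y in \<open>simp_all add: \<Delta>_def\<close>)
      then show "\<exists>C. (A, C) \<in> parcs G \<and> walk_bounds k i \<Delta> n (card (C \<inter> B))"
        using y Suc.prems arc vert by (intro exI[of _ C]) auto
    qed
    finally show ?case .
  }
qed

section \<open>The least admissible length\<close>

text \<open>With unit costs the cost of a walk is its length, so the infimum defining
  \<open>\<mu>\<close> is attained at \<open>p\<close>.\<close>

lemma graph_dist_eqI:
  assumes "pair_wf_digraph G"
    and "pre_digraph.awalk (with_proj G) A p B" "length p = n"
    and "\<And>q. pre_digraph.awalk (with_proj G) A q B \<Longrightarrow> n \<le> length q"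
  shows "graph_dist G A B = ereal (real n)"
proof -
  interpret pair_wf_digraph G by fact
  have cost: "awalk_cost (\<lambda>_. 1) q = real (length q)" for q
    by (induction q) auto
  show ?thesis
    unfolding graph_dist_def \<mu>_def cost
    using assms(2-4) by (intro antisym INF_greatest INF_lower2[of p]) auto
qed

text \<open>For \<open>x < i\<close> lengths 0 and 1 fail, length 2 requires
  \<open>k - \<Delta> \<le> x\<close>, and the odd upper bound is automatic. For
  \<open>i \<le> x\<close> the bounds involving \<open>\<Delta>\<close> decide, and each parity has
  its own least length.\<close>

lemma least_walk_bounds:
  fixes k i \<Delta> x :: int
  assumes i: "0 \<le> i" "i < k" and \<Delta>: "2 * i \<le> \<Delta>" "0 < \<Delta>" and x: "0 \<le> x" "x \<le> k"
  defines "d \<equiv> (if x < min i (k - \<Delta>) then 3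
     else if k - \<Delta> \<le> x \<and> x < i then \<lceil>real_of_int (k - x) / real_of_int (k - i)\<rceil>
     else min (2 * \<lceil>real_of_int (k - x) / real_of_int \<Delta>\<rceil>)
              (2 * \<lceil>real_of_int (x - i) / real_of_int \<Delta>\<rceil> + 1))"
  shows "0 \<le> d" and "walk_bounds k i \<Delta> (nat d) x"
    and "\<And>n. walk_bounds k i \<Delta> n x \<Longrightarrow> d \<le> int n"
proof -
  \<comment> \<open>Replaces each ceiling by the integer inequalities that occur in
    \<open>walk_bounds\<close>.\<close>
  have ceil: "\<lceil>real_of_int a / real_of_int b\<rceil> \<le> m \<longleftrightarrow> a \<le> m * b" if "0 < b" for a b m :: int
    using that by (simp add: ceiling_le_iff pos_divide_le_eq flip: of_int_mult)
  have "0 \<le> d \<and> walk_bounds k i \<Delta> (nat d) x \<and> (\<forall>n. walk_bounds k i \<Delta> n x \<longrightarrow> d \<le> int n)"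
  proof (cases "x < i")
    case True
    have small: "n \<noteq> 0 \<and> n \<noteq> 1 \<and> (n = 2 \<longrightarrow> k - \<Delta> \<le> x)" if "walk_bounds k i \<Delta> n x" for n
    proof (intro conjI notI impI)
      assume "n = 0"
      then show False using that True i by (simp add: walk_bounds_def)
    next
      assume "n = 1"
      then show False using that True i by (simp add: walk_bounds_def)
    next
      assume "n = 2"
      then show "k - \<Delta> \<le> x" using that by (simp add: walk_bounds_def)
    qed
    show ?thesis
    proof (cases "x < k - \<Delta>")
      case True
      then have "d = 3" using \<open>x < i\<close> by (simp add: d_def)
      \<comment> \<open>From \<open>0 \<le> x < k - \<Delta>\<close> and
        \<open>2 * i \<le> \<Delta>\<close> follows \<open>2 * i < k\<close>, so the lower bound
        \<open>3 * i - 2 * k\<close> is negative.\<close>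
      moreover have "walk_bounds k i \<Delta> 3 x"
        using True \<open>x < i\<close> assms by (simp add: walk_bounds_def)
      moreover have "3 \<le> n" if "walk_bounds k i \<Delta> n x" for n
        using small[OF that] True by linarith
      ultimately show ?thesis by auto
    next
      case False
      then have d: "d = \<lceil>real_of_int (k - x) / real_of_int (k - i)\<rceil>"
        using \<open>x < i\<close> by (simp add: d_def)
      have d_le: "d \<le> m \<longleftrightarrow> k - x \<le> m * (k - i)" for m
        unfolding d using i by (intro ceil) auto
      have "\<not> d \<le> 1" using d_le[of 1] \<open>x < i\<close> by auto
      define n where "n = nat d"
      have n: "d = int n" "2 \<le> n" using \<open>\<not> d \<le> 1\<close> by (auto simp: n_def)
      \<comment> \<open>Since \<open>n \<ge> 2\<close>, the parity condition follows from
        \<open>k - \<Delta> \<le> x\<close> or from \<open>x < i\<close>, leaving only the bound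
        with \<open>k - i\<close>.\<close>
      have "\<Delta> \<le> int (n div 2) * \<Delta>" "0 \<le> int (n div 2) * \<Delta>"
        using n \<Delta> by auto
      then have "walk_bounds k i \<Delta> n x"
        using d_le[of "int n"] n False \<open>x < i\<close> by (auto simp: walk_bounds_def)
      moreover have "d \<le> int l" if "walk_bounds k i \<Delta> l x" for l
        using that by (simp add: walk_bounds_def d_le)
      ultimately show ?thesis using n by simp
    qed
  next
    case False
    define e where "e = \<lceil>real_of_int (k - x) / real_of_int \<Delta>\<rceil>"
    define f where "f = \<lceil>real_of_int (x - i) / real_of_int \<Delta>\<rceil>"
    have d: "d = min (2 * e) (2 * f + 1)"
      using False by (simp add: d_def e_def f_def)
    have e_le: "e \<le> m \<longleftrightarrow> k - x \<le> m * \<Delta>" and f_le: "f \<le> m \<longleftrightarrow> x - i \<le> m * \<Delta>" for m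
      unfolding e_def f_def using \<Delta>(2) by (rule ceil)+
    have "0 \<le> e" "0 \<le> f"
      using e_le[of "- 1"] f_le[of "- 1"] False x \<Delta> by linarith+
    define a b where "a = nat e" and "b = nat f"
    have ab: "e = int a" "f = int b"
      using \<open>0 \<le> e\<close> \<open>0 \<le> f\<close> by (auto simp: a_def b_def)
    have "k - x \<le> int a * \<Delta>"
      using e_le[of e] ab by simp
    \<comment> \<open>If \<open>a = 0\<close>, the previous inequality gives
      \<open>k \<le> x\<close>; otherwise the left side is at most \<open>2 * i - k\<close>, which
      is below \<open>i\<close>.\<close>
    moreover from this have "k - 2 * (int a * (k - i)) \<le> x"
    proof (cases "a = 0")
      case False
      then have "k - i \<le> int a * (k - i)"
        using i by (simp add: mult_le_cancel_right1)
      then show ?thesis using \<open>\<not> x < i\<close> i by linarith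
    qed simp
    ultimately have "walk_bounds k i \<Delta> (2 * a) x"
      unfolding walk_bounds_even by simp
    moreover have "0 \<le> int b * (k - i)" using i by simp
    then have "walk_bounds k i \<Delta> (Suc (2 * b)) x"
      using f_le[of f] False unfolding walk_bounds_odd ab by linarith
    moreover have "nat d = 2 * a \<or> nat d = Suc (2 * b)"
      unfolding d ab by linarith
    ultimately have "walk_bounds k i \<Delta> (nat d) x" by auto
    \<comment> \<open>An even \<open>n\<close> is bounded below by \<open>2 * e\<close>, an odd one
      by \<open>2 * f + 1\<close>.\<close>
    moreover have "d \<le> int n" if "walk_bounds k i \<Delta> n x" for n
    proof (cases "even n")
      case True
      then have "e \<le> int (n div 2)"
        using that by (simp add: walk_bounds_def e_le)
      then show ?thesis using True d by auto
    next
      case False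
      then have "f \<le> int (n div 2)"
        using that by (simp add: walk_bounds_def f_le)
      then show ?thesis using False d by (auto elim!: oddE)
    qed
    ultimately show ?thesis using \<open>0 \<le> e\<close> \<open>0 \<le> f\<close> d by auto
  qed
  then show "0 \<le> d" "walk_bounds k i \<Delta> (nat d) x" "\<And>n. walk_bounds k i \<Delta> n x \<Longrightarrow> d \<le> int n"
    by auto
qed

theorem theorem3p4:
  fixes V :: "'a set" and v k i :: nat and A B :: "'a set" and x \<Delta> :: int
  assumes "finite V" and "card V = v"
    and "k < v" and "i < k" and "2 * k \<le> v"
    and "(v, k, i) \<noteq> (2 * k, k, 0)"
    and "\<Delta> = int v - 2 * int k + 2 * int i"
    and "A \<in> pverts (gen_johnson_graph V k i)"
    and "B \<in> pverts (gen_johnson_graph V k i)"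
    and "x = int (card (A \<inter> B))"
  shows "graph_dist (gen_johnson_graph V k i) A B = ereal (real_of_int
    (if x < min (int i) (int k - \<Delta>) then 3
     else if int k - \<Delta> \<le> x \<and> x < int i then
       \<lceil>real_of_int (int k - x) / real_of_int (int k - int i)\<rceil>
     else \<comment> \<open>remaining case: \<open>x \<ge> i\<close>\<close>
       min (2 * \<lceil>real_of_int (int k - x) / real_of_int \<Delta>\<rceil>)
           (2 * \<lceil>real_of_int (x - int i) / real_of_int \<Delta>\<rceil> + 1)))"
proof -
  let ?G = "gen_johnson_graph V k i"
  have wf: "pair_wf_digraph ?G"
    using pair_graph_gen_johnson_graph[of V i k] assms(1,4)
    by (meson pair_digraph.pair_wf_digraph pair_graph.axioms(1))
  have walks: "(\<exists>p. pre_digraph.awalk (with_proj ?G) A p B \<and> length p = n) \<longleftrightarrow>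
      walk_bounds (int k) (int i) \<Delta> n x" for n
    unfolding assms(7,10) using johnson_walk_iff[of V i k A B n] assms by auto
  have "finite B" "card B = k"
    using assms(1,9) finite_subset by (auto simp: gen_johnson_graph_def)
  then have x: "0 \<le> x" "x \<le> int k"
    using assms(10) card_mono[of B "A \<inter> B"] by auto
  \<comment> \<open>The first inequality is \<open>2 * k \<le> v\<close>. Equality
    \<open>\<Delta> = 0\<close> would force \<open>v = 2 * k\<close> and \<open>i = 0\<close>, the
    excluded triple.\<close>
  have \<Delta>: "2 * int i \<le> \<Delta>" "0 < \<Delta>"
    using assms(5-7) by auto
  define d where "d = (if x < min (int i) (int k - \<Delta>) then 3
     else if int k - \<Delta> \<le> x \<and> x < int i then
       \<lceil>real_of_int (int k - x) / real_of_int (int k - int i)\<rceil>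
     else min (2 * \<lceil>real_of_int (int k - x) / real_of_int \<Delta>\<rceil>)
              (2 * \<lceil>real_of_int (x - int i) / real_of_int \<Delta>\<rceil> + 1))"
  have least: "0 \<le> d" "walk_bounds (int k) (int i) \<Delta> (nat d) x"
      "\<And>n. walk_bounds (int k) (int i) \<Delta> n x \<Longrightarrow> d \<le> int n"
    unfolding d_def using least_walk_bounds[of "int i" "int k" \<Delta> x] assms(4) \<Delta> x by auto
  obtain p where "pre_digraph.awalk (with_proj ?G) A p B" "length p = nat d"
    using walks least(2) by blast
  then have "graph_dist ?G A B = ereal (real (nat d))"
    using wf walks least(3) by (intro graph_dist_eqI) force+
  then show ?thesis
    using least(1) unfolding d_def[symmetric] by simp
qed

end
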